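(* Let $n\ge 2$, $R>0$, and suppose $f\in C^0((0,R))$ and there exists a constant $f_0>0$ such that $f\ge f_0$ on $[0,R]$. Let $u$ denote the convex (classical) solution of problem (P) and, for each $\varepsilon>0$, let $u^\varepsilon$ be the monotone increasing classical solution of problem $(P_\varepsilon)$. Then: (i) $u^0:=\lim_{\varepsilon\to 0^+}u^\varepsilon$ exists pointwise and $u^\varepsilon$ converges to $u^0$ uniformly on every compact subset of $(0,R)$ as $\varepsilon\to0^+$. Moreover, $u^0$ is strictly convex in every compact subset, hence it is strictly convex in $[0,R]$. (ii) $u^\varepsilon_r$ converges to $u^0_r$ weakly-$*$ in $L^\infty((0,R))$ as $\varepsilon\to 0^+$. (iii) $u^0\equiv u$.
   Context: All functions are functions of the radial variable $r\in[0,R]$; subscripts $r$ denote derivatives in $r$. Given $f$ and a number $g(R)\in\mathbb{R}$, problem (P) (the radial form of the Monge–Ampère problem $\det D^2u=f$ in the ball $B_R(0)\subset\mathbb{R}^n$, $u=g$ on the boundary) is: find $u$ with $\frac{1}{n r^{n-1}}\big((u_r)^n\big)_r=f$ in $(0,R)$, $u(R)=g(R)$, $u_r(0)=0$. For $\varepsilon>0$, problem $(P_\varepsilon)$ (the radial form of the vanishing moment approximation $-\varepsilon\Delta^2u^\varepsilon+\det D^2u^\varepsilon=f$, $u^\varepsilon=g$, $\Delta u^\varepsilon=\varepsilon$ on the boundary) is: find $u^\varepsilon$ with $-\frac{\varepsilon}{r^{n-1}}\Big(r^{n-1}\Big(\frac{1}{r^{n-1}}\big(r^{n-1}u^\varepsilon_r\big)_r\Big)_r\Big)_r+\frac{1}{n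 r^{n-1}}\big((u^\varepsilon_r)^n\big)_r=f$ in $(0,R)$, $u^\varepsilon(R)=g(R)$, $u^\varepsilon_r(0)=0$, $|u^\varepsilon_{rr}(0)|<\infty$, $|u^\varepsilon_{rrr}(r)|=o(r^{-(n-1)})$ as $r\to0^+$, and $u^\varepsilon_{rr}(R)+\frac{n-1}{R}u^\varepsilon_r(R)=\varepsilon$. A classical solution is one whose derivatives appearing in the problem exist and satisfy all equations and conditions pointwise. Convexity refers to the function of $r$. *)

theory Defs
  imports "HOL-Analysis.Analysis"
begin

definition strictly_convex_on :: "real set \<Rightarrow> (real \<Rightarrow> real) \<Rightarrow> bool" where
  "strictly_convex_on S h \<longleftrightarrow> convex S \<and>
     (\<forall>x\<in>S. \<forall>y\<in>S. \<forall>t. x \<noteq> y \<longrightarrow> 0 < t \<longrightarrow> t < 1 \<longrightarrow>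
        h ((1 - t) * x + t * y) < (1 - t) * h x + t * h y)"

text \<open>Classical solution of (P): radial Monge-Ampere problem on [0,R],
  u1 is u_r (one-sided derivatives at the endpoints).\<close>
definition classical_sol_P ::
  "nat \<Rightarrow> real \<Rightarrow> (real \<Rightarrow> real) \<Rightarrow> real \<Rightarrow> (real \<Rightarrow> real) \<Rightarrow> bool" where
  "classical_sol_P n R f gR u \<longleftrightarrow>
    (\<exists>u1 D.
      (\<forall>r\<in>{0..R}. (u has_real_derivative u1 r) (at r within {0..R})) \<and>
      (\<forall>r\<in>{0<..<R}. ((\<lambda>s. (u1 s) ^ n) has_real_derivative D r) (at r)) \<and>
      (\<forall>r\<in>{0<..<R}. 1 / (real n * r ^ (n - 1)) * D r = f r) \<and>
      u R = gR \<and> u1 0 = 0)"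

text \<open>Classical solution of (P_eps): u1,u2,u3 are u_r,u_rr,u_rrr;
  A = (r^(n-1) u_r)_r, B = (A / r^(n-1))_r, C = (r^(n-1) B)_r, D = ((u_r)^n)_r.
  Finiteness of u_rr(0) is expressed by existence of the one-sided derivative u2 0.\<close>
definition classical_sol_Peps ::
  "nat \<Rightarrow> real \<Rightarrow> (real \<Rightarrow> real) \<Rightarrow> real \<Rightarrow> real \<Rightarrow> (real \<Rightarrow> real) \<Rightarrow> bool" where
  "classical_sol_Peps n R f gR \<epsilon> u \<longleftrightarrow>
    (\<exists>u1 u2 u3 A B C D.
      (\<forall>r\<in>{0..R}. (u has_real_derivative u1 r) (at r within {0..R})) \<and>
      (\<forall>r\<in>{0..R}. (u1 has_real_derivative u2 r) (at r within {0..R})) \<and>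
      (\<forall>r\<in>{0<..<R}. (u2 has_real_derivative u3 r) (at r)) \<and>
      (\<forall>r\<in>{0<..<R}. ((\<lambda>s. s ^ (n - 1) * u1 s) has_real_derivative A r) (at r)) \<and>
      (\<forall>r\<in>{0<..<R}. ((\<lambda>s. A s / s ^ (n - 1)) has_real_derivative B r) (at r)) \<and>
      (\<forall>r\<in>{0<..<R}. ((\<lambda>s. s ^ (n - 1) * B s) has_real_derivative C r) (at r)) \<and>
      (\<forall>r\<in>{0<..<R}. ((\<lambda>s. (u1 s) ^ n) has_real_derivative D r) (at r)) \<and>
      (\<forall>r\<in>{0<..<R}. - (\<epsilon> / r ^ (n - 1)) * C r + 1 / (real n * r ^ (n - 1)) * D r = f r) \<and>
      u R = gR \<and> u1 0 = 0 \<and>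
      ((\<lambda>r. \<bar>u3 r\<bar> * r ^ (n - 1)) \<longlongrightarrow> 0) (at_right 0) \<and>
      u2 R + (real n - 1) / R * u1 R = \<epsilon>)"

end

theory Submission
  imports Defs
begin

text \<open>Write \<open>w\<close> and \<open>p\<close> for the radial derivatives of the solutions of the approximate problem and
  of the Monge-Ampere problem. Integrating the approximate equation once from \<open>0\<close> gives
  \<open>\<epsilon> r ^ (n - 1) (w'' + (n - 1) (w' / r - w / r\<^sup>2)) = (w ^ n - p ^ n) / n\<close>.
  The maximum principle, together with the boundary condition at \<open>R\<close>, bounds \<open>w\<close> uniformly in
  \<open>\<epsilon>\<close>, and comparison with parabolas on small intervals shows that \<open>w\<close> tends to \<open>p\<close> pointwise on
  \<open>{0<..<R}\<close>. Dominated convergence then yields both the weak-star convergence of the derivatives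
  and, since all solutions agree at \<open>R\<close>, the uniform convergence of the solutions. Strict convexity
  of the limit holds because \<open>p ^ n\<close>, and hence \<open>p\<close>, is strictly increasing.\<close>

section \<open>Calculus on the real line\<close>

lemma power_add_le_power_add:
  fixes x y :: real
  assumes "0 \<le> x" "0 \<le> y" "1 \<le> n"
  shows "x ^ n + y ^ n \<le> (x + y) ^ n"
  using assms(3)
proof (induction n rule: nat_induct_at_least)
  case (Suc m)
  have "x ^ Suc m + y ^ Suc m \<le> (x + y) * (x ^ m + y ^ m)"
    using assms(1,2) by (simp add: algebra_simps)
  also have "\<dots> \<le> (x + y) * (x + y) ^ m"
    using Suc.IH assms(1,2) by (intro mult_left_mono) auto
  finally show ?case by simp
qed simp

lemma less_add_if_power_diff_less:
  fixes x y d :: real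
  assumes "x ^ n - y ^ n < d ^ n" "0 \<le> y" "0 \<le> d" "1 \<le> n"
  shows "x < y + d"
proof (rule power_less_imp_less_base)
  show "x ^ n < (y + d) ^ n"
    using assms power_add_le_power_add[of y d n] by linarith
qed (use assms in simp)

lemma has_real_derivative_interior_Icc:
  fixes h :: "real \<Rightarrow> real"
  assumes "(h has_real_derivative d) (at r within {a..b})" "r \<in> {a<..<b}"
  shows "(h has_real_derivative d) (at r)"
  using assms at_within_Icc_at[of a r b] by simp

lemma MVT_within:
  fixes h h' :: "real \<Rightarrow> real"
  assumes der: "\<And>r. r \<in> S \<Longrightarrow> (h has_real_derivative h' r) (at r within S)"
    and xy: "x < y" "{x..y} \<subseteq> S"
  obtains z where "x < z" "z < y" "h y - h x = (y - x) * h' z"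
proof -
  have "(h has_derivative (*) (h' r)) (at r within {x..y})" if "x \<le> r" "r \<le> y" for r
    using has_field_derivative_subset[OF der xy(2)] xy(2) that
    by (auto simp: has_field_derivative_def)
  then show thesis
    using mvt_simple[OF xy(1), of h "\<lambda>r. (*) (h' r)"] that by (auto simp: mult.commute)
qed

lemma second_derivative_nonpos_at_max:
  fixes g g' :: "real \<Rightarrow> real"
  assumes S: "open S" "\<xi> \<in> S"
    and der: "\<And>x. x \<in> S \<Longrightarrow> (g has_real_derivative g' x) (at x)"
    and der2: "(g' has_real_derivative d) (at \<xi>)"
    and max: "\<And>x. x \<in> S \<Longrightarrow> g x \<le> g \<xi>"
  shows "g' \<xi> = 0" "d \<le> 0"
proof -
  obtain e where e: "0 < e" "ball \<xi> e \<subseteq> S"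
    using S openE by blast
  have near: "x \<in> S" if "\<bar>\<xi> - x\<bar> < e" for x
    using that e(2) by (auto simp: dist_real_def)
  show crit: "g' \<xi> = 0"
    using max near by (intro DERIV_local_max[OF der[OF S(2)] e(1)]) auto
  show "d \<le> 0"
  proof (rule ccontr)
    assume "\<not> d \<le> 0"
    then obtain t where t: "0 < t" "\<And>s. 0 < s \<Longrightarrow> s < t \<Longrightarrow> 0 < g' (\<xi> + s)"
      using DERIV_pos_inc_right[OF der2] crit by auto
    define s where "s = min (t / 2) (e / 2)"
    have s: "0 < s" "s < t" "s < e"
      using t(1) e(1) by (auto simp: s_def)
    have in_S: "x \<in> S" if "x \<in> {\<xi>..\<xi> + s}" for x
      using that s by (intro near) auto
    have "g \<xi> < g (\<xi> + s)"
    proof (rule DERIV_pos_imp_increasing_open[where f = g])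
      show "continuous_on {\<xi>..\<xi> + s} g"
        using der in_S by (meson DERIV_isCont continuous_at_imp_continuous_on)
      show "\<exists>y. (g has_real_derivative y) (at x) \<and> 0 < y" if "\<xi> < x" "x < \<xi> + s" for x
        using that s t(2)[of "x - \<xi>"] der[OF in_S, of x] by auto
    qed (use s in simp)
    then show False
      using max[OF in_S, of "\<xi> + s"] s by simp
  qed
qed

lemma derivative_nonneg_at_right_end_max:
  fixes h :: "real \<Rightarrow> real"
  assumes "(h has_real_derivative d) (at b within {a..b})" "a < b"
    and max: "\<And>x. x \<in> {a..b} \<Longrightarrow> h x \<le> h b"
  shows "0 \<le> d"
proof (rule ccontr)
  assume "\<not> 0 \<le> d"
  then obtain e where e: "e > 0" "\<And>t. t > 0 \<Longrightarrow> b - t \<in> {a..b} \<Longrightarrow> t < e \<Longrightarrow> h b < h (b - t)"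
    using has_real_derivative_neg_dec_left[OF assms(1)] by auto
  define t where "t = min (e / 2) (b - a)"
  have "t > 0" "b - t \<in> {a..b}" "t < e"
    using e(1) assms(2) by (auto simp: t_def min_def)
  with e(2)[of t] max[of "b - t"] show False by auto
qed

lemma continuous_attains_sup_interior:
  fixes g :: "real \<Rightarrow> real"
  assumes cont: "continuous_on {a..b} g" and c: "c \<in> {a<..<b}" "g a \<le> g c" "g b \<le> g c"
  obtains \<xi> where "\<xi> \<in> {a<..<b}" "\<And>x. x \<in> {a..b} \<Longrightarrow> g x \<le> g \<xi>"
proof -
  obtain \<xi> where \<xi>: "\<xi> \<in> {a..b}" "\<And>x. x \<in> {a..b} \<Longrightarrow> g x \<le> g \<xi>"
    using continuous_attains_sup[OF compact_Icc _ cont] c(1) by auto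
  show thesis
  proof (cases "\<xi> \<in> {a<..<b}")
    case True
    with \<xi>(2) that show thesis by blast
  next
    case False
    with \<xi>(1) have "\<xi> = a \<or> \<xi> = b" by auto
    with c(2,3) have "g \<xi> \<le> g c" by auto
    with c(1) \<xi>(2) that[of c] show thesis by force
  qed
qed

lemma DERIV_zero_tendsto_at_right_imp_eq:
  fixes h :: "real \<Rightarrow> real"
  assumes der: "\<And>x. x \<in> {a<..<b} \<Longrightarrow> (h has_real_derivative 0) (at x)"
    and lim: "(h \<longlongrightarrow> l) (at_right a)" and x: "x \<in> {a<..<b}"
  shows "h x = l"
proof -
  have "a < b" using x by simp
  then have "\<forall>\<^sub>F y in at_right a. y \<in> {a<..<b}"
    by (rule eventually_at_right_real)
  then have "\<forall>\<^sub>F y in at_right a. h y = h x"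
    by eventually_elim (rule DERIV_isconst3[OF \<open>a < b\<close> _ x der])
  then have "(h \<longlongrightarrow> h x) (at_right a)"
    by (rule tendsto_eventually)
  with lim show ?thesis
    using tendsto_unique[OF trivial_limit_at_right_real] by blast
qed

section \<open>Derivatives of convex functions\<close>

lemma convex_on_above_tangent_within:
  fixes h :: "real \<Rightarrow> real"
  assumes conv: "convex_on S h" and xy: "x \<in> S" "y \<in> S"
    and der: "(h has_real_derivative d) (at x within S)"
  shows "d * (y - x) \<le> h y - h x"
proof -
  define \<gamma> where "\<gamma> t = (1 - t) * x + t * y" for t
  have \<gamma>: "\<gamma> ` {0..1} \<subseteq> S"
    using convex_on_imp_convex[OF conv] xy by (auto simp: \<gamma>_def convex_alt)
  have "(\<gamma> has_real_derivative y - x) (at 0 within {0..1})"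
    unfolding \<gamma>_def by (auto intro!: derivative_eq_intros)
  with has_field_derivative_subset[OF der \<gamma>]
  have "(h \<circ> \<gamma> has_real_derivative d * (y - x)) (at 0 within {0..1})"
    by (intro DERIV_image_chain) (auto simp: \<gamma>_def)
  then have lim: "((\<lambda>t. (h (\<gamma> t) - h x) / t) \<longlongrightarrow> d * (y - x)) (at_right 0)"
    by (simp add: has_field_derivative_iff at_within_Icc_at_right \<gamma>_def)
  have "\<forall>\<^sub>F t in at_right 0. t \<in> {0<..<1::real}"
    by (rule eventually_at_right_real) simp
  then have "\<forall>\<^sub>F t in at_right 0. (h (\<gamma> t) - h x) / t \<le> h y - h x"
  proof eventually_elim
    case (elim t)
    then have "h (\<gamma> t) \<le> (1 - t) * h x + t * h y"
      using convex_onD[OF conv, of t x y] xy by (simp add: \<gamma>_def)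
    with elim show ?case by (simp add: field_simps)
  qed
  with lim show ?thesis
    by (rule tendsto_upperbound) simp
qed

lemma convex_on_derivative_mono:
  fixes h h' :: "real \<Rightarrow> real"
  assumes conv: "convex_on S h"
    and der: "\<And>r. r \<in> S \<Longrightarrow> (h has_real_derivative h' r) (at r within S)"
  shows "mono_on S h'"
proof (rule mono_onI)
  fix x y assume xy: "x \<in> S" "y \<in> S" "x \<le> y"
  have "h' x * (y - x) \<le> h y - h x" "h' y * (x - y) \<le> h x - h y"
    using xy by (auto intro: convex_on_above_tangent_within[OF conv] der)
  then have "0 \<le> (h' y - h' x) * (y - x)"
    by (simp add: algebra_simps)
  with xy show "h' x \<le> h' y"
    by (cases "x = y") (auto simp: zero_le_mult_iff)
qed

text \<open>The tangent at \<open>z\<close>, evaluated at \<open>2 z - a\<close>, bounds \<open>h' z\<close> by two difference quotients at \<open>a\<close>.\<close>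
lemma convex_on_derivative_tendsto_at_right:
  fixes h h' :: "real \<Rightarrow> real"
  assumes conv: "convex_on {a..b} h" and "a < b"
    and der: "\<And>r. r \<in> {a..b} \<Longrightarrow> (h has_real_derivative h' r) (at r within {a..b})"
  shows "(h' \<longlongrightarrow> h' a) (at_right a)"
proof -
  define q where "q z = (h z - h a) / (z - a)" for z
  have q: "(q \<longlongrightarrow> h' a) (at_right a)"
    unfolding q_def using der[of a] \<open>a < b\<close>
    by (simp add: has_field_derivative_iff at_within_Icc_at_right)
  have "filterlim (\<lambda>z. 2 * z - a) (at_right a) (at_right a)"
    unfolding filterlim_at by (auto intro!: tendsto_eq_intros simp: eventually_at_filter)
  then have upper: "((\<lambda>z. 2 * q (2 * z - a) - q z) \<longlongrightarrow> h' a) (at_right a)"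
    by (auto intro!: tendsto_eq_intros filterlim_compose[OF q] q)
  have near: "\<forall>\<^sub>F z in at_right a. z \<in> {a<..<(a + b) / 2}"
    using \<open>a < b\<close> by (intro eventually_at_right_real) simp
  show ?thesis
  proof (rule tendsto_sandwich[OF _ _ tendsto_const upper])
    show "\<forall>\<^sub>F z in at_right a. h' a \<le> h' z"
      using near by eventually_elim
        (use \<open>a < b\<close> in \<open>auto intro!: mono_onD[OF convex_on_derivative_mono[OF conv der]]\<close>)
    show "\<forall>\<^sub>F z in at_right a. h' z \<le> 2 * q (2 * z - a) - q z"
      using near
    proof eventually_elim
      case (elim z)
      then have "h' z * (2 * z - a - z) \<le> h (2 * z - a) - h z"
        by (intro convex_on_above_tangent_within[OF conv] der) auto
      then have "h' z \<le> (h (2 * z - a) - h z) / (z - a)"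
        using elim by (simp add: pos_le_divide_eq)
      also have "\<dots> = 2 * q (2 * z - a) - q z"
        using elim by (simp add: q_def divide_simps) (simp add: algebra_simps)
      finally show ?case .
    qed
  qed
qed

lemma strictly_convex_on_linorderI:
  fixes h :: "real \<Rightarrow> real"
  assumes less: "\<And>t x y. 0 < t \<Longrightarrow> t < 1 \<Longrightarrow> x \<in> S \<Longrightarrow> y \<in> S \<Longrightarrow> x < y \<Longrightarrow>
      h ((1 - t) * x + t * y) < (1 - t) * h x + t * h y"
    and "convex S"
  shows "strictly_convex_on S h"
  unfolding strictly_convex_on_def
proof (intro conjI ballI allI impI)
  fix x y t :: real
  assume xyt: "x \<in> S" "y \<in> S" "x \<noteq> y" "0 < t" "t < 1"
  show "h ((1 - t) * x + t * y) < (1 - t) * h x + t * h y"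
  proof (cases "x < y")
    case True
    with xyt less[of t x y] show ?thesis by simp
  next
    case False
    with xyt less[of "1 - t" y x] show ?thesis by (simp add: algebra_simps)
  qed
qed fact

lemma strictly_convex_on_Icc:
  fixes h h' :: "real \<Rightarrow> real"
  assumes der: "\<And>r. r \<in> {a..b} \<Longrightarrow> (h has_real_derivative h' r) (at r within {a..b})"
    and mono: "strict_mono_on {a<..<b} h'"
  shows "strictly_convex_on {a..b} h"
proof (rule strictly_convex_on_linorderI)
  fix t x y :: real
  assume t: "0 < t" "t < 1" and xy: "x \<in> {a..b}" "y \<in> {a..b}" "x < y"
  define z where "z = (1 - t) * x + t * y"
  have z: "z - x = t * (y - x)" "y - z = (1 - t) * (y - x)"
    by (auto simp: z_def algebra_simps)
  with xy t have "x < z" "z < y"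
    by (smt (verit) mult_pos_pos)+
  obtain \<xi> where \<xi>: "x < \<xi>" "\<xi> < z" "h z - h x = (z - x) * h' \<xi>"
    by (rule MVT_within[OF der \<open>x < z\<close>]) (use xy \<open>z < y\<close> in auto)
  obtain \<eta> where \<eta>: "z < \<eta>" "\<eta> < y" "h y - h z = (y - z) * h' \<eta>"
    by (rule MVT_within[OF der \<open>z < y\<close>]) (use xy \<open>x < z\<close> in auto)
  have "h' \<xi> < h' \<eta>"
    by (rule strict_mono_onD[OF mono]) (use \<xi> \<eta> xy in auto)
  then have "0 < t * (1 - t) * (y - x) * (h' \<eta> - h' \<xi>)"
    using t xy by simp
  also have "\<dots> = t * (h y - h z) - (1 - t) * (h z - h x)"
    unfolding \<xi> \<eta> z by (simp add: algebra_simps)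
  also have "\<dots> = (1 - t) * h x + t * h y - h z"
    by (simp add: algebra_simps)
  finally show "h ((1 - t) * x + t * y) < (1 - t) * h x + t * h y"
    by (simp add: z_def)
qed simp

lemma strictly_convex_on_subset:
  assumes "strictly_convex_on S h" "K \<subseteq> S" "convex K"
  shows "strictly_convex_on K h"
  using assms unfolding strictly_convex_on_def by blast

section \<open>Convergence of integrals and of functions with convergent derivatives\<close>

lemma integral_dominated_convergence_at_right:
  fixes s :: "real \<Rightarrow> 'a \<Rightarrow> 'b::{banach, second_countable_topology}"
  assumes "f \<in> borel_measurable N" and meas: "\<And>t. a < t \<Longrightarrow> s t \<in> borel_measurable N"
    and "integrable N w"
    and lim: "AE x in N. ((\<lambda>t. s t x) \<longlongrightarrow> f x) (at_right a)"
    and bound: "\<forall>\<^sub>F t in at_right a. AE x in N. norm (s t x) \<le> w x"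
  shows "((\<lambda>t. integral\<^sup>L N (s t)) \<longlongrightarrow> integral\<^sup>L N f) (at_right a)"
proof -
  obtain b where b: "a < b" "\<And>t. a < t \<Longrightarrow> t < b \<Longrightarrow> AE x in N. norm (s t x) \<le> w x"
    using bound unfolding eventually_at_right_field by blast
  show ?thesis
  proof (rule tendsto_at_right_sequentially[OF b(1)])
    fix S :: "nat \<Rightarrow> real"
    assume S: "\<And>n. a < S n" "\<And>n. S n < b" "S \<longlonglongrightarrow> a"
    then have S_right: "filterlim S (at_right a) sequentially"
      by (auto simp: filterlim_at less_imp_neq[symmetric])
    show "(\<lambda>n. integral\<^sup>L N (s (S n))) \<longlonglongrightarrow> integral\<^sup>L N f"
    proof (rule integral_dominated_convergence)
      show "AE x in N. (\<lambda>n. s (S n) x) \<longlonglongrightarrow> f x"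
        using lim by eventually_elim (rule filterlim_compose[OF _ S_right])
    qed (use assms(1,3) meas b(2) S in auto)
  qed
qed

lemma bounded_convergence_integral_mult:
  fixes F :: "real \<Rightarrow> 'a \<Rightarrow> real"
  assumes G: "G \<in> borel_measurable N" and F: "\<And>t. a < t \<Longrightarrow> F t \<in> borel_measurable N"
    and lim: "\<And>x. x \<in> space N \<Longrightarrow> ((\<lambda>t. F t x) \<longlongrightarrow> G x) (at_right a)"
    and bound: "\<forall>\<^sub>F t in at_right a. \<forall>x\<in>space N. \<bar>F t x\<bar> \<le> M"
    and g: "integrable N g"
  shows "((\<lambda>t. integral\<^sup>L N (\<lambda>x. F t x * g x)) \<longlongrightarrow> integral\<^sup>L N (\<lambda>x. G x * g x)) (at_right a)"
proof (rule integral_dominated_convergence_at_right)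
  show "integrable N (\<lambda>x. M * \<bar>g x\<bar>)"
    using g by auto
  show "AE x in N. ((\<lambda>t. F t x * g x) \<longlongrightarrow> G x * g x) (at_right a)"
    by (intro AE_I2 tendsto_mult_right lim)
  show "\<forall>\<^sub>F t in at_right a. AE x in N. norm (F t x * g x) \<le> M * \<bar>g x\<bar>"
    using bound by eventually_elim (auto intro!: AE_I2 mult_right_mono simp: abs_mult)
qed (use G F g in \<open>auto intro: borel_measurable_times\<close>)

lemma (in finite_measure) bounded_convergence_L1:
  fixes F :: "real \<Rightarrow> 'a \<Rightarrow> real"
  assumes G: "G \<in> borel_measurable M" and F: "\<And>t. a < t \<Longrightarrow> F t \<in> borel_measurable M"
    and lim: "\<And>x. x \<in> space M \<Longrightarrow> ((\<lambda>t. F t x) \<longlongrightarrow> G x) (at_right a)"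
    and bound: "\<forall>\<^sub>F t in at_right a. \<forall>x\<in>space M. \<bar>F t x\<bar> \<le> C"
  shows "\<forall>\<^sub>F t in at_right a. integrable M (\<lambda>x. F t x - G x)"
    and "((\<lambda>t. integral\<^sup>L M (\<lambda>x. \<bar>F t x - G x\<bar>)) \<longlongrightarrow> 0) (at_right a)"
proof -
  have G_le: "\<bar>G x\<bar> \<le> C" if "x \<in> space M" for x
    by (rule tendsto_upperbound[OF tendsto_rabs[OF lim[OF that]]])
      (use bound that in \<open>auto elim: eventually_mono\<close>)
  have diff_bound: "\<forall>\<^sub>F t in at_right a. \<forall>x\<in>space M. \<bar>F t x - G x\<bar> \<le> 2 * C"
    using bound by eventually_elim (use G_le in fastforce)
  show "\<forall>\<^sub>F t in at_right a. integrable M (\<lambda>x. F t x - G x)"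
    using diff_bound eventually_at_right_less[of a]
    by eventually_elim
      (auto intro!: integrable_const_bound[where B = "2 * C"] AE_I2 borel_measurable_diff F G)
  have "((\<lambda>t. integral\<^sup>L M (\<lambda>x. \<bar>F t x - G x\<bar> * 1)) \<longlongrightarrow> integral\<^sup>L M (\<lambda>x. 0 * 1)) (at_right a)"
  proof (rule bounded_convergence_integral_mult)
    show "(\<lambda>x. \<bar>F t x - G x\<bar>) \<in> borel_measurable M" if "a < t" for t
      using F[OF that] G by (intro borel_measurable_abs borel_measurable_diff)
    show "((\<lambda>t. \<bar>F t x - G x\<bar>) \<longlongrightarrow> 0) (at_right a)" if "x \<in> space M" for x
      using lim[OF that] by (intro tendsto_rabs_zero) (simp add: LIM_zero)
    show "\<forall>\<^sub>F t in at_right a. \<forall>x\<in>space M. \<bar>\<bar>F t x - G x\<bar>\<bar> \<le> 2 * C"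
      using diff_bound by simp
  qed simp_all
  then show "((\<lambda>t. integral\<^sup>L M (\<lambda>x. \<bar>F t x - G x\<bar>)) \<longlongrightarrow> 0) (at_right a)"
    by simp
qed

lemma abs_diff_le_integral_abs_derivative:
  fixes h h' :: "real \<Rightarrow> real"
  assumes der: "\<And>r. r \<in> {a..b} \<Longrightarrow> (h has_real_derivative h' r) (at r within {a..b})"
    and h': "integrable (lebesgue_on {a<..<b}) h'" and r: "r \<in> {a..b}"
  shows "\<bar>h b - h r\<bar> \<le> integral\<^sup>L (lebesgue_on {a<..<b}) (\<lambda>x. \<bar>h' x\<bar>)"
proof -
  have "((\<lambda>x. \<bar>h' x\<bar>) has_integral integral\<^sup>L (lebesgue_on {a<..<b}) (\<lambda>x. \<bar>h' x\<bar>)) {a<..<b}"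
    using h' by (intro has_integral_integral_lebesgue_on) auto
  then have abs_on_Icc: "((\<lambda>x. \<bar>h' x\<bar>) has_integral
      integral\<^sup>L (lebesgue_on {a<..<b}) (\<lambda>x. \<bar>h' x\<bar>)) {a..b}"
    by (simp add: has_integral_Icc_iff_Ioo)
  then have abs_on_subinterval: "(\<lambda>x. \<bar>h' x\<bar>) integrable_on {r..b}"
    by (rule integrable_subinterval_real[OF has_integral_integrable]) (use r in auto)
  have ftc: "(h' has_integral (h b - h r)) {r..b}"
  proof (rule fundamental_theorem_of_calculus)
    fix x assume "x \<in> {r..b}"
    then have "(h has_real_derivative h' x) (at x within {r..b})"
      using r by (intro has_field_derivative_subset[OF der]) auto
    then show "(h has_vector_derivative h' x) (at x within {r..b})"
      by (rule has_real_derivative_iff_has_vector_derivative[THEN iffD1])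
  qed (use r in simp)
  then have "\<bar>h b - h r\<bar> = norm (integral {r..b} h')"
    by (simp add: integral_unique)
  also have "\<dots> \<le> integral {r..b} (\<lambda>x. \<bar>h' x\<bar>)"
    using ftc abs_on_subinterval
    by (intro Henstock_Kurzweil_Integration.integral_norm_bound_integral) auto
  also have "\<dots> \<le> integral {a..b} (\<lambda>x. \<bar>h' x\<bar>)"
    using abs_on_subinterval abs_on_Icc r by (intro integral_subset_le) auto
  also have "\<dots> = integral\<^sup>L (lebesgue_on {a<..<b}) (\<lambda>x. \<bar>h' x\<bar>)"
    using abs_on_Icc by (rule integral_unique)
  finally show ?thesis .
qed

locale bounded_derivative_convergence =
  fixes a b c M :: real and v w :: "real \<Rightarrow> real \<Rightarrow> real" and u p :: "real \<Rightarrow> real"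
  assumes DERIV_v:
      "\<And>t r. c < t \<Longrightarrow> r \<in> {a..b} \<Longrightarrow> (v t has_real_derivative w t r) (at r within {a..b})"
    and DERIV_u: "\<And>r. r \<in> {a..b} \<Longrightarrow> (u has_real_derivative p r) (at r within {a..b})"
    and continuous_on_w: "\<And>t. c < t \<Longrightarrow> continuous_on {a<..<b} (w t)"
    and continuous_on_p: "continuous_on {a<..<b} p"
    and w_tendsto: "\<And>r. r \<in> {a<..<b} \<Longrightarrow> ((\<lambda>t. w t r) \<longlongrightarrow> p r) (at_right c)"
    and w_bounded: "\<forall>\<^sub>F t in at_right c. \<forall>r\<in>{a<..<b}. \<bar>w t r\<bar> \<le> M"
begin

lemma borel_measurable_derivatives:
  shows "c < t \<Longrightarrow> w t \<in> borel_measurable (lebesgue_on {a<..<b})"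
    and "p \<in> borel_measurable (lebesgue_on {a<..<b})"
  using continuous_on_w continuous_on_p
  by (auto intro: continuous_imp_measurable_on_sets_lebesgue)

lemma weak_star_limit_deriv:
  assumes g: "integrable (lebesgue_on {a<..<b}) g"
  shows "((\<lambda>t. integral\<^sup>L (lebesgue_on {a<..<b}) (\<lambda>r. deriv (v t) r * g r))
    \<longlongrightarrow> integral\<^sup>L (lebesgue_on {a<..<b}) (\<lambda>r. deriv u r * g r)) (at_right c)"
proof -
  let ?N = "lebesgue_on {a<..<b}"
  have deriv_v: "deriv (v t) r = w t r" if "c < t" "r \<in> {a<..<b}" for t r
    by (rule DERIV_imp_deriv[OF has_real_derivative_interior_Icc[OF DERIV_v]]) (use that in auto)
  have deriv_u: "deriv u r = p r" if "r \<in> {a<..<b}" for r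
    by (rule DERIV_imp_deriv[OF has_real_derivative_interior_Icc[OF DERIV_u]]) (use that in auto)
  have "((\<lambda>t. integral\<^sup>L ?N (\<lambda>r. w t r * g r)) \<longlongrightarrow> integral\<^sup>L ?N (\<lambda>r. p r * g r)) (at_right c)"
    using w_tendsto w_bounded
    by (intro bounded_convergence_integral_mult borel_measurable_derivatives g) auto
  also have "integral\<^sup>L ?N (\<lambda>r. p r * g r) = integral\<^sup>L ?N (\<lambda>r. deriv u r * g r)"
    by (rule Bochner_Integration.integral_cong) (auto simp: deriv_u)
  finally show ?thesis
  proof (rule Lim_transform_eventually)
    show "\<forall>\<^sub>F t in at_right c.
        integral\<^sup>L ?N (\<lambda>r. w t r * g r) = integral\<^sup>L ?N (\<lambda>r. deriv (v t) r * g r)"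
      using eventually_at_right_less[of c]
      by eventually_elim (rule Bochner_Integration.integral_cong; auto simp: deriv_v)
  qed
qed

lemma uniform_limit_if_eq_at_right_end:
  assumes at_b: "\<And>t. c < t \<Longrightarrow> v t b = u b"
  shows "uniform_limit {a..b} v u (at_right c)"
proof -
  let ?N = "lebesgue_on {a<..<b}"
  define I where "I t = integral\<^sup>L ?N (\<lambda>r. \<bar>w t r - p r\<bar>)" for t
  have "finite_measure ?N"
    by (rule finite_measure_lebesgue_on) simp
  note L1 = finite_measure.bounded_convergence_L1[OF this, of p c w M]
  have int: "\<forall>\<^sub>F t in at_right c. integrable ?N (\<lambda>r. w t r - p r)"
    using w_tendsto w_bounded by (intro L1 borel_measurable_derivatives) auto
  have "(I \<longlongrightarrow> 0) (at_right c)"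
    unfolding I_def using w_tendsto w_bounded by (intro L1 borel_measurable_derivatives) auto
  then have I_less: "\<forall>\<^sub>F t in at_right c. I t < e" if "0 < e" for e
    using that by (rule order_tendstoD)
  show ?thesis
  proof (rule uniform_limitI)
    fix e :: real assume "0 < e"
    show "\<forall>\<^sub>F t in at_right c. \<forall>r\<in>{a..b}. dist (v t r) (u r) < e"
      using I_less[OF \<open>0 < e\<close>] int eventually_at_right_less[of c]
    proof eventually_elim
      case (elim t)
      have "dist (v t r) (u r) < e" if r: "r \<in> {a..b}" for r
      proof -
        have "\<bar>(v t b - u b) - (v t r - u r)\<bar> \<le> I t"
          unfolding I_def using elim
          by (intro abs_diff_le_integral_abs_derivative[OF _ _ r] DERIV_diff DERIV_v DERIV_u) auto
        with elim at_b[of t] show ?thesis by (simp add: dist_real_def)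
      qed
      then show ?case by blast
    qed
  qed
qed

end

section \<open>The derivative of the radial Laplacian\<close>

text \<open>If \<open>w = v'\<close> for a radial function \<open>v\<close> on \<open>n\<close>-dimensional space, this is the radial
  derivative of \<open>\<Delta>v = w' + (n - 1) w / r\<close>.\<close>
definition radial_laplacian_deriv ::
  "nat \<Rightarrow> (real \<Rightarrow> real) \<Rightarrow> (real \<Rightarrow> real) \<Rightarrow> (real \<Rightarrow> real) \<Rightarrow> real \<Rightarrow> real" where
  "radial_laplacian_deriv n w w' w'' r = w'' r + (real n - 1) * (w' r / r - w r / r\<^sup>2)"

lemma radial_laplacian_deriv_cmult:
  "radial_laplacian_deriv n (\<lambda>r. c * w r) (\<lambda>r. c * w' r) (\<lambda>r. c * w'' r) r
    = c * radial_laplacian_deriv n w w' w'' r"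
  by (simp add: radial_laplacian_deriv_def algebra_simps)

lemma DERIV_radial_laplacian:
  assumes "(w has_real_derivative w' r) (at r)" "(w' has_real_derivative w'' r) (at r)" "r \<noteq> 0"
  shows "((\<lambda>s. w' s + (real n - 1) * (w s / s)) has_real_derivative
    radial_laplacian_deriv n w w' w'' r) (at r)"
  using assms unfolding radial_laplacian_deriv_def
  by (auto intro!: derivative_eq_intros simp: field_simps power2_eq_square)

lemma DERIV_radial_flux:
  assumes "(w has_real_derivative d) (at r)" "r \<noteq> 0" "1 \<le> n"
  shows "((\<lambda>s. s ^ (n - 1) * w s) has_real_derivative
    r ^ (n - 1) * (d + (real n - 1) * (w r / r))) (at r)"
proof -
  obtain m where m: "n = Suc m"
    using \<open>1 \<le> n\<close> by (cases n) auto
  have "real m * r ^ (m - 1) = real m * r ^ m / r"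
    using \<open>r \<noteq> 0\<close> by (cases m) auto
  with assms(1) show ?thesis
    by (auto intro!: derivative_eq_intros simp: m algebra_simps)
qed

lemma radial_laplacian_deriv_unique:
  assumes w: "\<And>r. r \<in> S \<Longrightarrow> (w has_real_derivative w' r) (at r)"
    and w': "\<And>r. r \<in> S \<Longrightarrow> (w' has_real_derivative w'' r) (at r)"
    and A: "\<And>r. r \<in> S \<Longrightarrow> ((\<lambda>s. s ^ (n - 1) * w s) has_real_derivative A r) (at r)"
    and B: "((\<lambda>s. A s / s ^ (n - 1)) has_real_derivative b) (at r)"
    and S: "open S" "0 \<notin> S" "r \<in> S" and n: "1 \<le> n"
  shows "b = radial_laplacian_deriv n w w' w'' r"
proof -
  have "A s / s ^ (n - 1) = w' s + (real n - 1) * (w s / s)" if "s \<in> S" for s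
  proof -
    have "s \<noteq> 0" using that S(2) by auto
    with DERIV_unique[OF A[OF that] DERIV_radial_flux[OF w[OF that] _ n]] show ?thesis by simp
  qed
  with B have "((\<lambda>s. w' s + (real n - 1) * (w s / s)) has_real_derivative b) (at r)"
    by (rule has_field_derivative_transform_within_open[OF _ S(1,3)])
  moreover have "r \<noteq> 0" using S by auto
  ultimately show ?thesis
    using DERIV_radial_laplacian[where w'' = w'', OF w w'] S(3) DERIV_unique by blast
qed

lemma filterlim_mult_at_right_0:
  fixes c :: real
  assumes "0 < c"
  shows "filterlim (\<lambda>r. c * r) (at_right 0) (at_right 0)"
  unfolding filterlim_at
  using assms by (auto intro!: tendsto_eq_intros simp: eventually_at_filter)

lemma tendsto_power_mult_increment_0:
  fixes v v' \<xi> :: "real \<Rightarrow> real"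
  assumes "0 < R" and v: "\<And>r. r \<in> {0<..<R} \<Longrightarrow> (v has_real_derivative v' r) (at r)"
    and lim: "((\<lambda>r. r ^ Suc k * v' r) \<longlongrightarrow> 0) (at_right 0)"
    and \<xi>: "\<And>r. r \<in> {0<..<R} \<Longrightarrow> r / 2 < \<xi> r \<and> \<xi> r < r"
  shows "((\<lambda>r. r ^ k * (v r - v (\<xi> r))) \<longlongrightarrow> 0) (at_right 0)"
proof -
  have near: "\<forall>\<^sub>F r in at_right 0. r \<in> {0<..<R}"
    by (rule eventually_at_right_real[OF \<open>0 < R\<close>])
  have "\<exists>z>\<xi> r. z < r \<and> v r - v (\<xi> r) = (r - \<xi> r) * v' z" if "r \<in> {0<..<R}" for r
    using \<xi>[OF that] that by (intro MVT2 v) auto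
  then obtain \<eta> where \<eta>: "\<And>r. r \<in> {0<..<R} \<Longrightarrow>
      \<xi> r < \<eta> r \<and> \<eta> r < r \<and> v r - v (\<xi> r) = (r - \<xi> r) * v' (\<eta> r)"
    by metis
  have "filterlim \<eta> (at_right 0) (at_right 0)"
    unfolding filterlim_at
  proof
    show "\<forall>\<^sub>F r in at_right 0. \<eta> r \<in> {0<..} \<and> \<eta> r \<noteq> 0"
      using near by eventually_elim (use \<xi> \<eta> in force)
    show "(\<eta> \<longlongrightarrow> 0) (at_right 0)"
    proof (rule tendsto_sandwich[OF _ _ tendsto_const])
      show "\<forall>\<^sub>F r in at_right 0. 0 \<le> \<eta> r" "\<forall>\<^sub>F r in at_right 0. \<eta> r \<le> r"
        by (use near in eventually_elim, use \<xi> \<eta> in force)+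
    qed (rule tendsto_ident_at)
  qed
  from filterlim_compose[OF tendsto_rabs_zero[OF lim] this]
  have "((\<lambda>r. 2 ^ k * \<bar>\<eta> r ^ Suc k * v' (\<eta> r)\<bar>) \<longlongrightarrow> 0) (at_right 0)"
    by (rule tendsto_mult_right_zero)
  moreover have "\<forall>\<^sub>F r in at_right 0.
      norm (r ^ k * (v r - v (\<xi> r))) \<le> 2 ^ k * \<bar>\<eta> r ^ Suc k * v' (\<eta> r)\<bar>"
    using near
  proof eventually_elim
    case (elim r)
    have "r ^ k * (r - \<xi> r) \<le> (2 * \<eta> r) ^ k * \<eta> r"
      using elim \<xi>[of r] \<eta>[of r] by (intro mult_mono power_mono) auto
    then have "r ^ k * (r - \<xi> r) * \<bar>v' (\<eta> r)\<bar> \<le> (2 * \<eta> r) ^ k * \<eta> r * \<bar>v' (\<eta> r)\<bar>"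
      by (rule mult_right_mono) simp
    with elim \<xi>[of r] \<eta>[of r] show ?case
      by (simp add: abs_mult power_mult_distrib mult_ac)
  qed
  ultimately show ?thesis
    by (rule Lim_null_comparison[rotated])
qed

text \<open>On \<open>{r / 2..r}\<close>, \<open>w'\<close> oscillates by \<open>o(1 / r ^ k)\<close> and attains the slope of a secant of \<open>w\<close>,
  which tends to \<open>w' 0\<close>, as \<open>w r / r\<close> does.\<close>
lemma tendsto_power_mult_slope_defect_0:
  fixes w w' w'' :: "real \<Rightarrow> real"
  assumes "0 < R"
    and w: "\<And>r. r \<in> {0..R} \<Longrightarrow> (w has_real_derivative w' r) (at r within {0..R})"
    and w': "\<And>r. r \<in> {0<..<R} \<Longrightarrow> (w' has_real_derivative w'' r) (at r)"
    and w0: "w 0 = 0"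
    and w'': "((\<lambda>r. r ^ Suc k * w'' r) \<longlongrightarrow> 0) (at_right 0)"
  shows "((\<lambda>r. r ^ k * (w' r - w r / r)) \<longlongrightarrow> 0) (at_right 0)"
proof -
  have "\<exists>z. r / 2 < z \<and> z < r \<and> w r - w (r / 2) = (r - r / 2) * w' z" if "r \<in> {0<..<R}" for r
    by (rule MVT_within[OF w, of "r / 2" r]) (use that in auto)
  then obtain \<xi> where \<xi>: "\<And>r. r \<in> {0<..<R} \<Longrightarrow>
      r / 2 < \<xi> r \<and> \<xi> r < r \<and> w r - w (r / 2) = (r - r / 2) * w' (\<xi> r)"
    by metis
  have quot: "((\<lambda>r. w r / r) \<longlongrightarrow> w' 0) (at_right 0)"
    using w[of 0] w0 \<open>0 < R\<close> by (simp add: has_field_derivative_iff at_within_Icc_at_right)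
  have "((\<lambda>r. w (1 / 2 * r) / (1 / 2 * r)) \<longlongrightarrow> w' 0) (at_right 0)"
    by (rule filterlim_compose[OF quot filterlim_mult_at_right_0]) simp
  then have "((\<lambda>r. r ^ k * (w r / r - w (1 / 2 * r) / (1 / 2 * r)))
      \<longlongrightarrow> 0 ^ k * (w' 0 - w' 0)) (at_right 0)"
    by (intro tendsto_intros quot)
  moreover have "((\<lambda>r. r ^ k * (w' r - w' (\<xi> r))) \<longlongrightarrow> 0) (at_right 0)"
    by (rule tendsto_power_mult_increment_0[OF \<open>0 < R\<close> w' w'']) (use \<xi> in auto)
  ultimately have "((\<lambda>r. r ^ k * (w' r - w' (\<xi> r))
      + r ^ k * (w r / r - w (1 / 2 * r) / (1 / 2 * r))) \<longlongrightarrow> 0) (at_right 0)"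
    using tendsto_add by fastforce
  moreover have "\<forall>\<^sub>F r in at_right 0. r ^ k * (w' r - w' (\<xi> r))
      + r ^ k * (w r / r - w (1 / 2 * r) / (1 / 2 * r)) = r ^ k * (w' r - w r / r)"
    using eventually_at_right_real[OF \<open>0 < R\<close>]
  proof eventually_elim
    case (elim r)
    then have secant: "w r / r - w (1 / 2 * r) / (1 / 2 * r) = w' (\<xi> r) - w r / r"
      using \<xi>[of r] by (simp add: field_simps)
    show ?case unfolding secant by (simp add: algebra_simps)
  qed
  ultimately show ?thesis
    by (rule Lim_transform_eventually)
qed

lemma tendsto_power_mult_radial_laplacian_deriv_0:
  assumes "2 \<le> n" "0 < R"
    and w: "\<And>r. r \<in> {0..R} \<Longrightarrow> (w has_real_derivative w' r) (at r within {0..R})"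
    and w': "\<And>r. r \<in> {0<..<R} \<Longrightarrow> (w' has_real_derivative w'' r) (at r)"
    and w0: "w 0 = 0"
    and w'': "((\<lambda>r. r ^ (n - 1) * w'' r) \<longlongrightarrow> 0) (at_right 0)"
  shows "((\<lambda>r. r ^ (n - 1) * radial_laplacian_deriv n w w' w'' r) \<longlongrightarrow> 0) (at_right 0)"
proof -
  obtain k where k: "n - 1 = Suc k"
    using \<open>2 \<le> n\<close> by (cases "n - 1") auto
  have "((\<lambda>r. r ^ k * (w' r - w r / r)) \<longlongrightarrow> 0) (at_right 0)"
    using tendsto_power_mult_slope_defect_0[OF \<open>0 < R\<close> w w' w0] w'' k by simp
  then have "((\<lambda>r. r ^ (n - 1) * w'' r + (real n - 1) * (r ^ k * (w' r - w r / r)))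
      \<longlongrightarrow> 0) (at_right 0)"
    using tendsto_add[OF w'' tendsto_mult_right_zero] by simp
  then show ?thesis
  proof (rule Lim_transform_eventually)
    show "\<forall>\<^sub>F r in at_right 0. r ^ (n - 1) * w'' r + (real n - 1) * (r ^ k * (w' r - w r / r))
        = r ^ (n - 1) * radial_laplacian_deriv n w w' w'' r"
      using eventually_at_right_real[OF \<open>0 < R\<close>]
      by eventually_elim
        (simp add: radial_laplacian_deriv_def k field_simps power2_eq_square del: One_nat_def)
  qed
qed

definition barrier_bound :: "nat \<Rightarrow> real \<Rightarrow> real \<Rightarrow> real \<Rightarrow> real" where
  "barrier_bound n M c h
    = 4 * M / h\<^sup>2 + (real n - 1) * (4 * M / (h * (c - h)) + M / (c - h)\<^sup>2)"

lemma barrier_bound_nonneg: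
  assumes "0 \<le> M" "0 < h" "h < c" "1 \<le> n"
  shows "0 \<le> barrier_bound n M c h"
  using assms by (simp add: barrier_bound_def)

text \<open>The point is a maximum of \<open>w x - K (x - c)\<^sup>2\<close>. With \<open>K = 2 M / h\<^sup>2\<close> the parabola reaches
  \<open>2 M\<close> at the end points, so that the maximum is also attained in the interior.\<close>
lemma exists_point_radial_laplacian_deriv_le:
  fixes w w' w'' :: "real \<Rightarrow> real"
  assumes n: "1 \<le> n" and h: "0 < h" "h < c"
    and w: "\<And>r. r \<in> {c - h..c + h} \<Longrightarrow> (w has_real_derivative w' r) (at r)"
    and w': "\<And>r. r \<in> {c - h..c + h} \<Longrightarrow> (w' has_real_derivative w'' r) (at r)"
    and M: "\<And>r. r \<in> {c - h..c + h} \<Longrightarrow> \<bar>w r\<bar> \<le> M"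
  obtains \<xi> where "\<xi> \<in> {c - h<..<c + h}" "w c \<le> w \<xi>"
    "radial_laplacian_deriv n w w' w'' \<xi> \<le> barrier_bound n M c h"
proof -
  define K where "K = 2 * M / h\<^sup>2"
  define g where "g x = w x - K * (x - c)\<^sup>2" for x
  have "\<bar>w c\<bar> \<le> M" using M[of c] h by simp
  then have "0 \<le> M" by simp
  then have "0 \<le> K" by (simp add: K_def)
  have "K * h\<^sup>2 = 2 * M" using h by (simp add: K_def)
  with M[of "c - h"] M[of "c + h"] \<open>\<bar>w c\<bar> \<le> M\<close> h have ends: "g (c - h) \<le> g c" "g (c + h) \<le> g c"
    by (auto simp: g_def)
  have "continuous_on {c - h..c + h} w"
    using w by (meson DERIV_isCont continuous_at_imp_continuous_on)
  then have "continuous_on {c - h..c + h} g"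
    unfolding g_def by (intro continuous_intros)
  then obtain \<xi> where \<xi>: "\<xi> \<in> {c - h<..<c + h}" "\<And>x. x \<in> {c - h..c + h} \<Longrightarrow> g x \<le> g \<xi>"
    by (rule continuous_attains_sup_interior) (use ends h in auto)
  have "w' \<xi> - K * (2 * (\<xi> - c)) = 0" "w'' \<xi> - K * 2 \<le> 0"
    by (rule second_derivative_nonpos_at_max[where S = "{c - h<..<c + h}" and g = g and \<xi> = \<xi>
          and g' = "\<lambda>x. w' x - K * (2 * (x - c))"];
        use \<xi> in \<open>auto simp: g_def[abs_def] intro!: derivative_eq_intros w w'\<close>)+
  then have w'_eq: "w' \<xi> = 2 * K * (\<xi> - c)" and w''_le: "w'' \<xi> \<le> 2 * K" by auto
  have "g c \<le> g \<xi>" using \<xi>(2)[of c] h by simp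
  moreover have "0 \<le> K * (\<xi> - c)\<^sup>2" using \<open>0 \<le> K\<close> by simp
  ultimately have w_le: "w c \<le> w \<xi>" by (simp add: g_def)
  have "2 * K * (\<xi> - c) \<le> 2 * K * h"
    using \<xi>(1) \<open>0 \<le> K\<close> by (intro mult_left_mono) auto
  then have "w' \<xi> / \<xi> \<le> 2 * K * h / (c - h)"
    unfolding w'_eq using \<xi>(1) h \<open>0 \<le> K\<close> by (intro frac_le) auto
  moreover have "- w \<xi> / \<xi>\<^sup>2 \<le> M / (c - h)\<^sup>2"
    using M[of \<xi>] \<xi>(1) h \<open>0 \<le> M\<close> by (intro frac_le power_mono) auto
  ultimately have "w' \<xi> / \<xi> - w \<xi> / \<xi>\<^sup>2 \<le> 2 * K * h / (c - h) + M / (c - h)\<^sup>2"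
    by simp
  then have "radial_laplacian_deriv n w w' w'' \<xi>
      \<le> 2 * K + (real n - 1) * (2 * K * h / (c - h) + M / (c - h)\<^sup>2)"
    unfolding radial_laplacian_deriv_def using n w''_le by (intro add_mono mult_left_mono) auto
  also have "\<dots> = barrier_bound n M c h"
    using h by (simp add: barrier_bound_def K_def power2_eq_square)
  finally show thesis
    using that \<xi>(1) w_le by blast
qed

lemma radial_laplacian_deriv_nonpos_at_max:
  fixes w w' w'' :: "real \<Rightarrow> real"
  assumes "1 \<le> n" "open S" "\<xi> \<in> S" "0 \<le> w \<xi>" "0 < \<xi>"
    and w: "\<And>x. x \<in> S \<Longrightarrow> (w has_real_derivative w' x) (at x)"
    and w': "(w' has_real_derivative w'' \<xi>) (at \<xi>)"
    and max: "\<And>x. x \<in> S \<Longrightarrow> w x \<le> w \<xi>"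
  shows "radial_laplacian_deriv n w w' w'' \<xi> \<le> 0"
proof -
  have "w' \<xi> = 0" "w'' \<xi> \<le> 0"
    by (rule second_derivative_nonpos_at_max[OF assms(2,3) w w' max]; assumption)+
  moreover have "0 \<le> (real n - 1) * (w \<xi> / \<xi>\<^sup>2)"
    using assms(1,4) by simp
  ultimately show ?thesis
    by (simp add: radial_laplacian_deriv_def)
qed

section \<open>The gradient of the Monge-Ampere solution\<close>

locale monge_ampere_gradient =
  fixes n :: nat and R :: real and f p :: "real \<Rightarrow> real"
  assumes n_ge_2: "2 \<le> n" and R_pos: "0 < R"
    and f_pos: "\<And>r. r \<in> {0<..<R} \<Longrightarrow> 0 < f r"
    and DERIV_p_power: "\<And>r. r \<in> {0<..<R} \<Longrightarrow>
      ((\<lambda>s. p s ^ n) has_real_derivative real n * r ^ (n - 1) * f r) (at r)"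
    and mono_p: "mono_on {0..R} p" and p_0: "p 0 = 0" and p_tendsto_0: "(p \<longlongrightarrow> 0) (at_right 0)"
begin

lemma p_nonneg: "0 \<le> p r" if "r \<in> {0..R}"
  using mono_onD[OF mono_p, of 0 r] that p_0 by auto

lemma p_le: "p r \<le> p R" if "r \<in> {0..R}"
  using mono_onD[OF mono_p, of r R] that by auto

lemma continuous_on_p: "continuous_on {0<..<R} p"
proof -
  have "continuous_on {0<..<R} (\<lambda>s. p s ^ n)"
    using DERIV_p_power by (meson DERIV_isCont continuous_at_imp_continuous_on)
  then have "continuous_on {0<..<R} (\<lambda>s. root n (p s ^ n))"
    by (intro continuous_on_real_root)
  then show ?thesis
    by (rule continuous_on_cong[THEN iffD1, rotated 2])
      (use n_ge_2 p_nonneg in \<open>auto intro!: real_root_power_cancel\<close>)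
qed

lemma strict_mono_on_p: "strict_mono_on {0<..<R} p"
proof (rule strict_mono_onI)
  fix x y assume xy: "x \<in> {0<..<R}" "y \<in> {0<..<R}" "x < y"
  have "p x ^ n < p y ^ n"
  proof (rule DERIV_pos_imp_increasing[OF \<open>x < y\<close>])
    fix r assume "x \<le> r" "r \<le> y"
    with xy have r: "r \<in> {0<..<R}" by auto
    then have "0 < real n * r ^ (n - 1) * f r"
      using n_ge_2 f_pos by simp
    with DERIV_p_power[OF r]
    show "\<exists>d. ((\<lambda>s. p s ^ n) has_real_derivative d) (at r) \<and> 0 < d" by blast
  qed
  then show "p x < p y"
    by (rule power_less_imp_less_base) (use xy p_nonneg in auto)
qed

lemma first_integral:
  assumes C: "\<And>r. r \<in> {0<..<R} \<Longrightarrow> ((\<lambda>s. s ^ (n - 1) * B s) has_real_derivative C r) (at r)"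
    and D: "\<And>r. r \<in> {0<..<R} \<Longrightarrow> ((\<lambda>s. w s ^ n) has_real_derivative D r) (at r)"
    and ode: "\<And>r. r \<in> {0<..<R} \<Longrightarrow>
      - (\<epsilon> / r ^ (n - 1)) * C r + 1 / (real n * r ^ (n - 1)) * D r = f r"
    and B_lim: "((\<lambda>r. r ^ (n - 1) * B r) \<longlongrightarrow> 0) (at_right 0)" and w_lim: "(w \<longlongrightarrow> 0) (at_right 0)"
    and r: "r \<in> {0<..<R}"
  shows "\<epsilon> * r ^ (n - 1) * B r = (w r ^ n - p r ^ n) / real n"
proof -
  define E where "E s = (w s ^ n - p s ^ n) / real n - \<epsilon> * (s ^ (n - 1) * B s)" for s
  have "(E has_real_derivative 0) (at s)" if s: "s \<in> {0<..<R}" for s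
  proof -
    have "(E has_real_derivative (D s - real n * s ^ (n - 1) * f s) / real n - \<epsilon> * C s) (at s)"
      unfolding E_def
      by (intro DERIV_diff DERIV_cmult DERIV_cdivide C D DERIV_p_power s)
    moreover have "(D s - real n * s ^ (n - 1) * f s) / real n - \<epsilon> * C s = 0"
      unfolding ode[OF s, symmetric] using s n_ge_2 by (simp add: field_simps)
    ultimately show ?thesis by simp
  qed
  moreover have "(E \<longlongrightarrow> (0 ^ n - 0 ^ n) / real n - \<epsilon> * 0) (at_right 0)"
    unfolding E_def using n_ge_2 by (intro tendsto_intros B_lim w_lim p_tendsto_0) auto
  then have "(E \<longlongrightarrow> 0) (at_right 0)" by simp
  ultimately have "E r = 0"
    using r by (rule DERIV_zero_tendsto_at_right_imp_eq)
  then show ?thesis by (simp add: E_def)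
qed

end

lemma classical_sol_P_gradient:
  assumes n: "2 \<le> n" and R: "0 < R" and f: "\<And>r. r \<in> {0<..<R} \<Longrightarrow> 0 < f r"
    and sol: "classical_sol_P n R f gR u" and conv: "convex_on {0..R} u"
  obtains p where "\<And>r. r \<in> {0..R} \<Longrightarrow> (u has_real_derivative p r) (at r within {0..R})"
    "u R = gR" "monge_ampere_gradient n R f p"
proof -
  obtain p D where
    u: "\<And>r. r \<in> {0..R} \<Longrightarrow> (u has_real_derivative p r) (at r within {0..R})"
    and D: "\<And>r. r \<in> {0<..<R} \<Longrightarrow> ((\<lambda>s. p s ^ n) has_real_derivative D r) (at r)"
    and ode: "\<And>r. r \<in> {0<..<R} \<Longrightarrow> 1 / (real n * r ^ (n - 1)) * D r = f r"
    and boundary: "u R = gR" "p 0 = 0"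
    using sol unfolding classical_sol_P_def by blast
  have "monge_ampere_gradient n R f p"
  proof
    show "((\<lambda>s. p s ^ n) has_real_derivative real n * r ^ (n - 1) * f r) (at r)"
      if "r \<in> {0<..<R}" for r
      using D[OF that] ode[OF that, symmetric] that n by simp
    show "mono_on {0..R} p"
      by (rule convex_on_derivative_mono[OF conv u])
    show "(p \<longlongrightarrow> 0) (at_right 0)"
      using convex_on_derivative_tendsto_at_right[OF conv R u] boundary by simp
  qed (use n R f boundary in auto)
  with u boundary that show thesis by blast
qed

section \<open>Gradients of the regularized solutions\<close>

locale regularized_gradient = monge_ampere_gradient +
  fixes \<epsilon> :: real and w w' w'' :: "real \<Rightarrow> real"
  assumes eps_pos: "0 < \<epsilon>"
    and DERIV_w: "\<And>r. r \<in> {0..R} \<Longrightarrow> (w has_real_derivative w' r) (at r within {0..R})"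
    and DERIV_w': "\<And>r. r \<in> {0<..<R} \<Longrightarrow> (w' has_real_derivative w'' r) (at r)"
    and w_nonneg: "\<And>r. r \<in> {0<..<R} \<Longrightarrow> 0 \<le> w r"
    and integrated_ode: "\<And>r. r \<in> {0<..<R} \<Longrightarrow>
      \<epsilon> * r ^ (n - 1) * radial_laplacian_deriv n w w' w'' r = (w r ^ n - p r ^ n) / real n"
    and w_0: "w 0 = 0" and w'_R: "w' R + (real n - 1) / R * w R = \<epsilon>"
begin

lemmas DERIV_w_interior = has_real_derivative_interior_Icc[OF DERIV_w]

lemma continuous_on_w: "continuous_on {0..R} w"
  using DERIV_w by (rule DERIV_continuous_on)

lemma w_le:
  assumes r: "r \<in> {0..R}"
  shows "w r \<le> max (p R) (\<epsilon> * R)"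
proof -
  obtain \<xi> where \<xi>: "\<xi> \<in> {0..R}" "\<And>x. x \<in> {0..R} \<Longrightarrow> w x \<le> w \<xi>"
    using continuous_attains_sup[OF compact_Icc _ continuous_on_w] R_pos by auto
  consider (left) "\<xi> = 0" | (right) "\<xi> = R" | (interior) "\<xi> \<in> {0<..<R}"
    using \<xi>(1) by force
  then have "w \<xi> \<le> max (p R) (\<epsilon> * R)"
  proof cases
    case left
    have "0 \<le> \<epsilon> * R" using eps_pos R_pos by simp
    then show ?thesis using left w_0 by simp
  next
    case right
    have "0 \<le> w' R"
      by (rule derivative_nonneg_at_right_end_max[OF DERIV_w]) (use R_pos \<xi> right in auto)
    then have "0 \<le> R * w' R" using R_pos by simp
    also have "\<dots> = \<epsilon> * R - (real n - 1) * w R"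
      using w'_R R_pos by (simp add: field_simps)
    finally have "(real n - 1) * w R \<le> \<epsilon> * R" by simp
    moreover have "1 * w R \<le> (real n - 1) * w R"
      using n_ge_2 \<xi>(2)[of 0] right w_0 R_pos by (intro mult_right_mono) auto
    ultimately show ?thesis using right by simp
  next
    case interior
    have "radial_laplacian_deriv n w w' w'' \<xi> \<le> 0"
      by (rule radial_laplacian_deriv_nonpos_at_max[of _ "{0<..<R}"])
        (use interior \<xi>(2) n_ge_2 w_nonneg DERIV_w_interior DERIV_w' in auto)
    then have "\<epsilon> * \<xi> ^ (n - 1) * radial_laplacian_deriv n w w' w'' \<xi> \<le> 0"
      using eps_pos interior by (intro mult_nonneg_nonpos) auto
    then have "w \<xi> ^ n \<le> p \<xi> ^ n"
      unfolding integrated_ode[OF interior] using n_ge_2 by (simp add: divide_le_0_iff)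
    then have "w \<xi> \<le> p \<xi>"
      by (rule power_mono_iff[THEN iffD1, rotated 3])
        (use interior n_ge_2 w_nonneg p_nonneg in auto)
    then show ?thesis using p_le[of \<xi>] \<xi>(1) by simp
  qed
  with \<xi>(2)[OF r] show ?thesis by simp
qed

lemma abs_w_le:
  assumes "\<epsilon> \<le> 1" "r \<in> {0<..<R}"
  shows "\<bar>w r\<bar> \<le> max (p R) R"
proof -
  have "w r \<le> max (p R) (\<epsilon> * R)"
    using assms(2) by (intro w_le) simp
  also have "\<dots> \<le> max (p R) R"
    using assms(1) R_pos by (intro max.mono) auto
  finally show ?thesis
    using w_nonneg[OF assms(2)] by simp
qed

lemma exists_point_power_diff_less:
  assumes h: "0 < h" "h < c" "c + h < R" and eps: "\<epsilon> \<le> 1" and \<sigma>: "\<bar>\<sigma>\<bar> = 1"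
    and small: "real n * R ^ (n - 1) * barrier_bound n (max (p R) R) c h * \<epsilon> < d"
  obtains \<xi> where "\<xi> \<in> {c - h..c + h}" "\<sigma> * w c \<le> \<sigma> * w \<xi>" "\<sigma> * (w \<xi> ^ n - p \<xi> ^ n) < d"
proof -
  let ?L = "radial_laplacian_deriv n w w' w''"
  have in_interval: "r \<in> {0<..<R}" "r \<in> {0..R}" if "r \<in> {c - h..c + h}" for r
    using that h by auto
  have abs_w: "\<bar>\<sigma> * w r\<bar> \<le> max (p R) R" if "r \<in> {c - h..c + h}" for r
    using abs_w_le[OF eps in_interval(1)[OF that]] \<sigma> by (simp add: abs_mult)
  obtain \<xi> where \<xi>: "\<xi> \<in> {c - h<..<c + h}" "\<sigma> * w c \<le> \<sigma> * w \<xi>"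
      "\<sigma> * ?L \<xi> \<le> barrier_bound n (max (p R) R) c h"
    by (rule exists_point_radial_laplacian_deriv_le[of n h c "\<lambda>r. \<sigma> * w r" "\<lambda>r. \<sigma> * w' r"
          "\<lambda>r. \<sigma> * w'' r" "max (p R) R"])
      (use h n_ge_2 abs_w in_interval DERIV_w_interior DERIV_w' in
        \<open>auto intro!: DERIV_cmult simp: radial_laplacian_deriv_cmult\<close>)
  have bound_nonneg: "0 \<le> barrier_bound n (max (p R) R) c h"
    using h n_ge_2 R_pos by (intro barrier_bound_nonneg) auto
  have "\<sigma> * ((w \<xi> ^ n - p \<xi> ^ n) / real n) = \<sigma> * (\<epsilon> * \<xi> ^ (n - 1) * ?L \<xi>)"
    using integrated_ode[of \<xi>] in_interval(1)[of \<xi>] \<xi>(1) by simp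
  also have "\<dots> = \<epsilon> * \<xi> ^ (n - 1) * (\<sigma> * ?L \<xi>)"
    by (rule mult.left_commute)
  also have "\<dots> \<le> \<epsilon> * \<xi> ^ (n - 1) * barrier_bound n (max (p R) R) c h"
    using \<xi>(1,3) h eps_pos by (intro mult_left_mono) auto
  also have "\<dots> \<le> \<epsilon> * R ^ (n - 1) * barrier_bound n (max (p R) R) c h"
    using \<xi>(1) h eps_pos bound_nonneg by (intro mult_right_mono mult_left_mono power_mono) auto
  also have "\<dots> < d / real n"
    using small n_ge_2 by (simp add: field_simps)
  finally have "\<sigma> * (w \<xi> ^ n - p \<xi> ^ n) < d"
    using n_ge_2 by (simp add: divide_less_cancel)
  with \<xi>(1,2) that[of \<xi>] show thesis by simp
qed

lemma abs_diff_less_if_barrier_bound_less: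
  assumes h: "0 < h" "h < c" "c + h < R" and \<delta>: "0 < \<delta>" and eps: "\<epsilon> \<le> 1"
    and p: "\<And>r. r \<in> {c - h..c + h} \<Longrightarrow> \<bar>p r - p c\<bar> \<le> \<delta>"
    and small: "real n * R ^ (n - 1) * barrier_bound n (max (p R) R) c h * \<epsilon> < \<delta> ^ n"
  shows "\<bar>w c - p c\<bar> < 2 * \<delta>"
proof -
  have nonneg: "0 \<le> w r" "0 \<le> p r" if "r \<in> {c - h..c + h}" for r
    using that h by (auto intro: w_nonneg p_nonneg)
  obtain \<xi> where \<xi>: "\<xi> \<in> {c - h..c + h}" "w c \<le> w \<xi>" "w \<xi> ^ n - p \<xi> ^ n < \<delta> ^ n"
    using exists_point_power_diff_less[OF h eps _ small, of 1] by auto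
  have "w \<xi> < p \<xi> + \<delta>"
    by (rule less_add_if_power_diff_less[OF \<xi>(3)]) (use \<xi>(1) nonneg \<delta> n_ge_2 in auto)
  then have upper: "w c < p c + 2 * \<delta>"
    using \<xi>(2) p[OF \<xi>(1)] by linarith
  obtain \<eta> where \<eta>: "\<eta> \<in> {c - h..c + h}" "w \<eta> \<le> w c" "p \<eta> ^ n - w \<eta> ^ n < \<delta> ^ n"
    using exists_point_power_diff_less[OF h eps _ small, of "- 1"] by auto
  have "p \<eta> < w \<eta> + \<delta>"
    by (rule less_add_if_power_diff_less[OF \<eta>(3)]) (use \<eta>(1) nonneg \<delta> n_ge_2 in auto)
  then have "p c - 2 * \<delta> < w c"
    using \<eta>(2) p[OF \<eta>(1)] by linarith
  with upper show ?thesis by linarith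
qed

end

lemma (in monge_ampere_gradient) regularized_gradient_tendsto:
  assumes w: "\<And>\<epsilon>. 0 < \<epsilon> \<Longrightarrow> regularized_gradient n R f p \<epsilon> (w \<epsilon>) (w' \<epsilon>) (w'' \<epsilon>)"
    and c: "c \<in> {0<..<R}"
  shows "((\<lambda>\<epsilon>. w \<epsilon> c) \<longlongrightarrow> p c) (at_right 0)"
proof (rule tendstoI)
  fix e :: real assume e: "0 < e"
  have "isCont p c"
    using continuous_on_p c by (simp add: continuous_on_eq_continuous_at)
  then obtain d where d: "0 < d" "\<And>r. \<bar>r - c\<bar> < d \<Longrightarrow> \<bar>p r - p c\<bar> < e / 2"
    using e unfolding continuous_at_eps_delta dist_real_def by (metis half_gt_zero)
  define h where "h = min d (min c (R - c)) / 2"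
  have h: "0 < h" "h < d" "h < c" "c + h < R"
    using d(1) c by (auto simp: h_def min_def field_simps)
  define K where "K = real n * R ^ (n - 1) * barrier_bound n (max (p R) R) c h"
  have "((\<lambda>\<epsilon>. K * \<epsilon>) \<longlongrightarrow> 0) (at_right 0)"
    by (auto intro!: tendsto_eq_intros)
  then have "\<forall>\<^sub>F \<epsilon> in at_right 0. K * \<epsilon> < (e / 2) ^ n"
    using e by (intro order_tendstoD) auto
  moreover have "\<forall>\<^sub>F \<epsilon> in at_right 0. \<epsilon> \<in> {0<..<1::real}"
    by (rule eventually_at_right_real) simp
  ultimately show "\<forall>\<^sub>F \<epsilon> in at_right 0. dist (w \<epsilon> c) (p c) < e"
  proof eventually_elim
    case (elim \<epsilon>)
    then interpret regularized_gradient n R f p \<epsilon> "w \<epsilon>" "w' \<epsilon>" "w'' \<epsilon>"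
      by (intro w) simp
    have "\<bar>w \<epsilon> c - p c\<bar> < 2 * (e / 2)"
      by (rule abs_diff_less_if_barrier_bound_less[OF h(1,3,4)])
        (use h(2) d(2) e elim in \<open>auto simp: K_def intro!: less_imp_le\<close>)
    then show ?case by (simp add: dist_real_def)
  qed
qed

lemma (in monge_ampere_gradient) classical_sol_Peps_gradient:
  assumes sol: "classical_sol_Peps n R f gR \<epsilon> v" and mono: "mono_on {0..R} v" and "0 < \<epsilon>"
  obtains w w' w'' where
    "\<And>r. r \<in> {0..R} \<Longrightarrow> (v has_real_derivative w r) (at r within {0..R})"
    "v R = gR" "regularized_gradient n R f p \<epsilon> w w' w''"
proof -
  obtain w w' w'' A B C D where
    v: "\<And>r. r \<in> {0..R} \<Longrightarrow> (v has_real_derivative w r) (at r within {0..R})"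
    and w: "\<And>r. r \<in> {0..R} \<Longrightarrow> (w has_real_derivative w' r) (at r within {0..R})"
    and w': "\<And>r. r \<in> {0<..<R} \<Longrightarrow> (w' has_real_derivative w'' r) (at r)"
    and A: "\<And>r. r \<in> {0<..<R} \<Longrightarrow> ((\<lambda>s. s ^ (n - 1) * w s) has_real_derivative A r) (at r)"
    and B: "\<And>r. r \<in> {0<..<R} \<Longrightarrow> ((\<lambda>s. A s / s ^ (n - 1)) has_real_derivative B r) (at r)"
    and C: "\<And>r. r \<in> {0<..<R} \<Longrightarrow> ((\<lambda>s. s ^ (n - 1) * B s) has_real_derivative C r) (at r)"
    and D: "\<And>r. r \<in> {0<..<R} \<Longrightarrow> ((\<lambda>s. w s ^ n) has_real_derivative D r) (at r)"
    and ode: "\<And>r. r \<in> {0<..<R} \<Longrightarrow>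
      - (\<epsilon> / r ^ (n - 1)) * C r + 1 / (real n * r ^ (n - 1)) * D r = f r"
    and boundary: "v R = gR" "w 0 = 0" "w' R + (real n - 1) / R * w R = \<epsilon>"
    and w''_abs: "((\<lambda>r. \<bar>w'' r\<bar> * r ^ (n - 1)) \<longlongrightarrow> 0) (at_right 0)"
    using sol unfolding classical_sol_Peps_def by (elim exE conjE) blast
  note w_interior = has_real_derivative_interior_Icc[OF w]
  have B_eq: "B r = radial_laplacian_deriv n w w' w'' r" if "r \<in> {0<..<R}" for r
    by (rule radial_laplacian_deriv_unique[where S = "{0<..<R}", OF w_interior w' A B])
      (use that n_ge_2 in auto)
  have "((\<lambda>r. \<bar>r ^ (n - 1) * w'' r\<bar>) \<longlongrightarrow> 0) (at_right 0)"
    by (rule Lim_transform_eventually[OF w''_abs])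
      (auto simp: eventually_at_filter abs_mult mult.commute)
  then have "((\<lambda>r. r ^ (n - 1) * w'' r) \<longlongrightarrow> 0) (at_right 0)"
    by (rule tendsto_rabs_zero_cancel)
  then have "((\<lambda>r. r ^ (n - 1) * radial_laplacian_deriv n w w' w'' r) \<longlongrightarrow> 0) (at_right 0)"
    by (intro tendsto_power_mult_radial_laplacian_deriv_0[OF n_ge_2 R_pos w w' boundary(2)])
  then have B_lim: "((\<lambda>r. r ^ (n - 1) * B r) \<longlongrightarrow> 0) (at_right 0)"
    by (rule Lim_transform_eventually)
      (use eventually_at_right_real[OF R_pos] in \<open>eventually_elim, simp add: B_eq\<close>)
  have w_lim: "(w \<longlongrightarrow> 0) (at_right 0)"
    using continuous_on_Icc_at_rightD[OF DERIV_continuous_on[OF w] R_pos] boundary(2) by simp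
  have "regularized_gradient n R f p \<epsilon> w w' w''"
  proof
    show "0 \<le> w r" if "r \<in> {0<..<R}" for r
      by (rule mono_on_imp_deriv_nonneg[OF mono has_real_derivative_interior_Icc[OF v]])
        (use that in auto)
    show "\<epsilon> * r ^ (n - 1) * radial_laplacian_deriv n w w' w'' r = (w r ^ n - p r ^ n) / real n"
      if "r \<in> {0<..<R}" for r
      using first_integral[OF C D ode B_lim w_lim that] B_eq[OF that] by simp
  qed (use \<open>0 < \<epsilon>\<close> w w' boundary in auto)
  with v boundary that show thesis by blast
qed

lemma (in monge_ampere_gradient) bounded_derivative_convergence_regularized:
  assumes u: "\<And>r. r \<in> {0..R} \<Longrightarrow> (u has_real_derivative p r) (at r within {0..R})"
    and v: "\<And>\<epsilon> r. 0 < \<epsilon> \<Longrightarrow> r \<in> {0..R} \<Longrightarrow> (v \<epsilon> has_real_derivative w \<epsilon> r) (at r within {0..R})"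
    and w: "\<And>\<epsilon>. 0 < \<epsilon> \<Longrightarrow> regularized_gradient n R f p \<epsilon> (w \<epsilon>) (w' \<epsilon>) (w'' \<epsilon>)"
  shows "bounded_derivative_convergence 0 R 0 (max (p R) R) v w u p"
proof
  show "continuous_on {0<..<R} (w \<epsilon>)" if "0 < \<epsilon>" for \<epsilon>
    by (rule continuous_on_subset[OF regularized_gradient.continuous_on_w[OF w[OF that]]]) auto
  have "\<forall>\<^sub>F \<epsilon> in at_right 0. \<epsilon> \<in> {0<..<1::real}"
    by (rule eventually_at_right_real) simp
  then show "\<forall>\<^sub>F \<epsilon> in at_right 0. \<forall>r\<in>{0<..<R}. \<bar>w \<epsilon> r\<bar> \<le> max (p R) R"
  proof eventually_elim
    case (elim \<epsilon>)
    then interpret regularized_gradient n R f p \<epsilon> "w \<epsilon>" "w' \<epsilon>" "w'' \<epsilon>"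
      by (intro w) simp
    show ?case using abs_w_le elim by simp
  qed
qed (use u v continuous_on_p regularized_gradient_tendsto[OF w] in auto)

lemma (in monge_ampere_gradient) bounded_derivative_convergence_Peps:
  assumes u: "\<And>r. r \<in> {0..R} \<Longrightarrow> (u has_real_derivative p r) (at r within {0..R})"
    and sol: "\<forall>\<epsilon>>0. classical_sol_Peps n R f gR \<epsilon> (v \<epsilon>)" and mono: "\<forall>\<epsilon>>0. mono_on {0..R} (v \<epsilon>)"
  obtains w where "bounded_derivative_convergence 0 R 0 (max (p R) R) v w u p"
    "\<And>\<epsilon>. 0 < \<epsilon> \<Longrightarrow> v \<epsilon> R = gR"
proof -
  have "\<exists>w w' w''. (\<forall>r\<in>{0..R}. (v \<epsilon> has_real_derivative w r) (at r within {0..R})) \<and>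
      v \<epsilon> R = gR \<and> regularized_gradient n R f p \<epsilon> w w' w''" if "0 < \<epsilon>" for \<epsilon>
    using classical_sol_Peps_gradient[of gR \<epsilon> "v \<epsilon>"] sol mono that by metis
  then obtain w w' w'' where
    "\<And>\<epsilon> r. 0 < \<epsilon> \<Longrightarrow> r \<in> {0..R} \<Longrightarrow> (v \<epsilon> has_real_derivative w \<epsilon> r) (at r within {0..R})"
    "\<And>\<epsilon>. 0 < \<epsilon> \<Longrightarrow> regularized_gradient n R f p \<epsilon> (w \<epsilon>) (w' \<epsilon>) (w'' \<epsilon>)"
    and boundary: "\<And>\<epsilon>. 0 < \<epsilon> \<Longrightarrow> v \<epsilon> R = gR"
    by metis
  with u have "bounded_derivative_convergence 0 R 0 (max (p R) R) v w u p"
    by (intro bounded_derivative_convergence_regularized)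
  with boundary that show thesis by blast
qed

theorem theorem3p13:
  fixes n :: nat and R f0 gR :: real and f u :: "real \<Rightarrow> real"
    and ue :: "real \<Rightarrow> real \<Rightarrow> real"
  assumes n: "n \<ge> 2" and R: "R > 0"
    and f_cont: "continuous_on {0<..<R} f"
    and f0: "f0 > 0" and f_ge: "\<forall>r\<in>{0..R}. f r \<ge> f0"
    and u_sol: "classical_sol_P n R f gR u" and u_convex: "convex_on {0..R} u"
    and ue_sol: "\<forall>\<epsilon>>0. classical_sol_Peps n R f gR \<epsilon> (ue \<epsilon>)"
    and ue_mono: "\<forall>\<epsilon>>0. mono_on {0..R} (ue \<epsilon>)"
  shows "\<exists>u0 :: real \<Rightarrow> real.
     (\<forall>r\<in>{0..R}. ((\<lambda>\<epsilon>. ue \<epsilon> r) \<longlongrightarrow> u0 r) (at_right 0)) \<and>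
     (\<forall>K. compact K \<and> K \<subseteq> {0<..<R} \<longrightarrow> uniform_limit K ue u0 (at_right 0)) \<and>
     (\<forall>K. compact K \<and> K \<subseteq> {0<..<R} \<and> convex K \<longrightarrow> strictly_convex_on K u0) \<and>
     strictly_convex_on {0..R} u0 \<and>
     (\<forall>g :: real \<Rightarrow> real. integrable (lebesgue_on {0<..<R}) g \<longrightarrow>
        ((\<lambda>\<epsilon>. integral\<^sup>L (lebesgue_on {0<..<R}) (\<lambda>r. deriv (ue \<epsilon>) r * g r))
          \<longlongrightarrow> integral\<^sup>L (lebesgue_on {0<..<R}) (\<lambda>r. deriv u0 r * g r)) (at_right 0)) \<and>
     (\<forall>r\<in>{0..R}. u0 r = u r)"
proof -
  have "0 < f r" if "r \<in> {0<..<R}" for r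
    using f0 f_ge[rule_format, of r] that by simp
  then obtain p where u: "\<And>r. r \<in> {0..R} \<Longrightarrow> (u has_real_derivative p r) (at r within {0..R})"
    and u_boundary: "u R = gR" and p: "monge_ampere_gradient n R f p"
    using classical_sol_P_gradient[OF n R _ u_sol u_convex] by blast
  interpret monge_ampere_gradient n R f p by (fact p)
  obtain w where w: "bounded_derivative_convergence 0 R 0 (max (p R) R) ue w u p"
    and ue_boundary: "\<And>\<epsilon>. 0 < \<epsilon> \<Longrightarrow> ue \<epsilon> R = gR"
    using bounded_derivative_convergence_Peps[OF u ue_sol ue_mono] by blast
  interpret bounded_derivative_convergence 0 R 0 "max (p R) R" ue w u p by (fact w)
  have uniform: "uniform_limit {0..R} ue u (at_right 0)"
    using ue_boundary u_boundary by (intro uniform_limit_if_eq_at_right_end) simp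
  have strict: "strictly_convex_on {0..R} u"
    by (rule strictly_convex_on_Icc[OF u strict_mono_on_p])
  have subset: "K \<subseteq> {0..R}" if "K \<subseteq> {0<..<R}" for K
    using that by force
  show ?thesis
    using tendsto_uniform_limitI[OF uniform] uniform_limit_on_subset[OF uniform subset]
      strictly_convex_on_subset[OF strict subset] strict weak_star_limit_deriv
    by (intro exI[of _ u] conjI allI impI ballI) auto
qed

end
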